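(* Let $\Omega\subset\mathbb{H}$ be the slice domain and $G:\Omega\to\mathbb{H}$ the slice regular function constructed in the context, and let $\widetilde\Omega:=\bigcup_{x+yJ\in\Omega}(x+y\mathbb{S})$ (with $x,y\in\mathbb R$, $J\in\mathbb S$) be the axially symmetric completion of $\Omega$. Then there is no slice regular function $\widetilde G:\widetilde\Omega\to\mathbb{H}$ with $\widetilde G|_\Omega=G$.
   Context: $\mathbb{H}$ denotes the quaternions with the Euclidean topology, $\mathbb{S}=\{q\in\mathbb{H}:q^2=-1\}$, $\mathbb{C}_J=\{x+yJ:x,y\in\mathbb{R}\}$ for $J\in\mathbb{S}$, $x+y\mathbb{S}=\{x+yJ:J\in\mathbb{S}\}$, $\mathbb{R}^+=(0,+\infty)$. A function from an open set of $\mathbb{C}_J$ to $\mathbb{H}$ is (left) holomorphic if it has continuous partial derivatives and $\frac12(\frac{\partial}{\partial x}+J\frac{\partial}{\partial y})f(x+yJ)=0$. A function on a domain $\Omega\subset\mathbb{H}$ is slice regular if its restriction to $\Omega_J:=\Omega\cap\mathbb{C}_J$ is holomorphic for every $J\in\mathbb{S}$. A domain $\Omega\subset\mathbb{H}$ is a slice domain if $\Omega\cap\mathbb{R}\ne\varnothing$ and $\Omega_J$ is a domain in $\mathbb{C}_J$ for all $J\in\mathbb{S}$. For $I,J\in\mathbb{S}$, $P_I^J:\mathbb{C}_I\to\mathbb{C}_J$ is $x+yI\mapsto x+yJ$. Construction. Fix $I\in\mathbb{S}$. For $\imath=0,1$ define $\gamma_\imath:[0,1)\to\mathbb{C}_I$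 by $\gamma_\imath(t)=-1+2I+e^{(-1)^\imath2\pi It}$ for $t\in[0,\frac12]$ and $\gamma_\imath(t)=2I-(1-t)^{-1}$ for $t\in(\frac12,1)$. For $s\in[0,1]$ put $\gamma_s:=(1-s)\gamma_0+s\gamma_1$; write $\gamma_s$ also for its image. Let $g:\mathbb{R}^++\{2I\}\to\mathbb{R}$, $g(x+2I)=\ln x$, where $\mathbb{R}^++\{2I\}=\{x+2I: x\in\mathbb R^+\}$. For each $t\in[0,1]$ let $f_t:\mathbb{C}_I\setminus\gamma_t\to\mathbb{C}_I$ be the holomorphic extension of $g$; all $f_t$ coincide on $\mathbb{R}$. For $J\in\mathbb{S}$ set $T(J):=\min\{|J-I|,1\}$, $\mathbb{C}_J^+:=\{x+yJ:x,y\in\mathbb{R},y\ge0\}$, and $U_J^+:=\mathbb{C}_J^+\setminus P_I^J(\gamma_{T(J)})$. Define on $U_J^+$ $$F_J^+(x+yJ):=\frac{1-JI}{2}f_{T(J)}(x+yI)+\frac{1+JI}{2}f_{T(J)}(x-yI)$$ for $x,y\in\mathbb R$, $y\ge 0$, $x+yJ\in U_J^+$. Finally let $\Omega:=\bigcup_{J\in\mathbb{S}}U_J^+$, which is a slice domain in $\mathbb{H}$, and let $G:\Omega\to\mathbb{H}$ be the slice regular function with $G|_{U_J^+}:=F_J^+$ for every $J\in\mathbb{S}$. *)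

theory Defs
  imports "HOL-Analysis.Analysis"
begin

section \<open>Quaternions\<close>

datatype quat = Quat (qre: real) (qi: real) (qj: real) (qk: real)

lemma quat_eq_iff:
  "x = y \<longleftrightarrow> qre x = qre y \<and> qi x = qi y \<and> qj x = qj y \<and> qk x = qk y"
  by (cases x; cases y) simp

instantiation quat :: real_vector
begin

definition "0 = Quat 0 0 0 0"
definition "x + y = Quat (qre x + qre y) (qi x + qi y) (qj x + qj y) (qk x + qk y)"
definition "- x = Quat (- qre x) (- qi x) (- qj x) (- qk x)"
definition "x - y = Quat (qre x - qre y) (qi x - qi y) (qj x - qj y) (qk x - qk y)"
definition "r *\<^sub>R x = Quat (r * qre x) (r * qi x) (r * qj x) (r * qk x)"

instance
  by standard
    (simp_all add: quat_eq_iff zero_quat_def plus_quat_def uminus_quat_def minus_quat_def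
      scaleR_quat_def algebra_simps)

end

lemma quat_sel_simps [simp]:
  "qre 0 = 0" "qi 0 = 0" "qj 0 = 0" "qk 0 = 0"
  "qre (x + y) = qre x + qre y" "qi (x + y) = qi x + qi y"
  "qj (x + y) = qj x + qj y" "qk (x + y) = qk x + qk y"
  "qre (- x) = - qre x" "qi (- x) = - qi x" "qj (- x) = - qj x" "qk (- x) = - qk x"
  "qre (x - y) = qre x - qre y" "qi (x - y) = qi x - qi y"
  "qj (x - y) = qj x - qj y" "qk (x - y) = qk x - qk y"
  "qre (r *\<^sub>R x) = r * qre x" "qi (r *\<^sub>R x) = r * qi x"
  "qj (r *\<^sub>R x) = r * qj x" "qk (r *\<^sub>R x) = r * qk x"
  by (simp_all add: zero_quat_def plus_quat_def uminus_quat_def minus_quat_def scaleR_quat_def)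

instantiation quat :: real_inner
begin

definition "x \<bullet> y = qre x * qre y + qi x * qi y + qj x * qj y + qk x * qk y"
definition "norm (x :: quat) = sqrt (x \<bullet> x)"
definition "sgn (x :: quat) = x /\<^sub>R norm x"
definition "dist (x :: quat) y = norm (x - y)"
definition [code del]:
  "(uniformity :: (quat \<times> quat) filter) = (INF e\<in>{0<..}. principal {(x, y). dist x y < e})"
definition [code del]:
  "open (S :: quat set) \<longleftrightarrow> (\<forall>x\<in>S. \<forall>\<^sub>F (x', y) in uniformity. x' = x \<longrightarrow> y \<in> S)"

instance
proof
  fix x :: quat
  show "0 \<le> x \<bullet> x"
    by (simp add: inner_quat_def)
  show "x \<bullet> x = 0 \<longleftrightarrow> x = 0"
    by (auto simp: inner_quat_def quat_eq_iff add_nonneg_eq_0_iff)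
qed (auto simp: norm_quat_def sgn_quat_def dist_quat_def uniformity_quat_def open_quat_def
    inner_quat_def algebra_simps)

end

instantiation quat :: real_normed_div_algebra
begin

definition "1 = Quat 1 0 0 0"
definition "x * y = Quat
  (qre x * qre y - qi x * qi y - qj x * qj y - qk x * qk y)
  (qre x * qi y + qi x * qre y + qj x * qk y - qk x * qj y)
  (qre x * qj y - qi x * qk y + qj x * qre y + qk x * qi y)
  (qre x * qk y + qi x * qj y - qj x * qi y + qk x * qre y)"
definition "inverse (x :: quat) = Quat (qre x) (- qi x) (- qj x) (- qk x) /\<^sub>R (x \<bullet> x)"
definition "x div (y :: quat) = x * inverse y"

instance
proof
  fix x y z :: quat and r :: real
  show "x * y * z = x * (y * z)"
    by (simp add: times_quat_def quat_eq_iff algebra_simps)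
  show "(x + y) * z = x * z + y * z" "x * (y + z) = x * y + x * z"
    by (simp_all add: times_quat_def quat_eq_iff algebra_simps)
  show "1 * x = x" "x * 1 = x" "(0 :: quat) \<noteq> 1"
    by (simp_all add: times_quat_def one_quat_def quat_eq_iff)
  show "r *\<^sub>R x * y = r *\<^sub>R (x * y)" "x * r *\<^sub>R y = r *\<^sub>R (x * y)"
    by (simp_all add: times_quat_def quat_eq_iff algebra_simps)
  have inv: "inverse x * x = (inverse (x \<bullet> x) * (x \<bullet> x)) *\<^sub>R 1"
    "x * inverse x = (inverse (x \<bullet> x) * (x \<bullet> x)) *\<^sub>R 1"
    by (simp_all add: times_quat_def inverse_quat_def quat_eq_iff one_quat_def inner_quat_def
        algebra_simps)
  show "x \<noteq> 0 \<Longrightarrow> inverse x * x = 1" "x \<noteq> 0 \<Longrightarrow> x * inverse x = 1"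
    unfolding inv by simp_all
  show "x div y = x * inverse y"
    by (rule divide_quat_def)
  show "inverse (0 :: quat) = 0"
    by (simp add: inverse_quat_def inner_quat_def)
  have "(x * y) \<bullet> (x * y) = (x \<bullet> x) * (y \<bullet> y)"
    by (simp add: times_quat_def inner_quat_def) algebra
  then show "norm (x * y) = norm x * norm y"
    by (simp add: norm_quat_def real_sqrt_mult)
qed

end

instantiation quat :: euclidean_space
begin

definition "Basis = {Quat 1 0 0 0, Quat 0 1 0 0, Quat 0 0 1 0, Quat 0 0 0 1}"

instance
proof
  fix x :: quat
  show "(\<forall>u\<in>Basis. x \<bullet> u = 0) \<longleftrightarrow> x = 0"
    unfolding Basis_quat_def ball_simps by (simp add: inner_quat_def quat_eq_iff)
qed (auto simp: Basis_quat_def inner_quat_def)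

end


section \<open>Slice regular functions\<close>

definition imag_units :: "quat set"  (\<open>\<S>\<close>) where
  "\<S> = {q. q\<^sup>2 = - 1}"

definition slice_pt :: "quat \<Rightarrow> real \<Rightarrow> real \<Rightarrow> quat" where
  "slice_pt J x y = of_real x + y *\<^sub>R J"

definition slice_plane :: "quat \<Rightarrow> quat set" where
  "slice_plane J = {slice_pt J x y | x y. True}"

text \<open>
  Functions on subsets of the quaternions are total functions considered on the subset only.
  The predicates below are meant for \<open>D\<close> open in \<open>slice_plane J\<close> and for domains \<open>\<Omega>\<close>
  (then the values outside the set do not matter); this is not built into them.
\<close>

definition slice_holomorphic_on :: "quat \<Rightarrow> quat set \<Rightarrow> (quat \<Rightarrow> quat) \<Rightarrow> bool" where
  "slice_holomorphic_on J D f \<longleftrightarrow>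
    (\<exists>fx fy. continuous_on D fx \<and> continuous_on D fy \<and>
      (\<forall>x y. slice_pt J x y \<in> D \<longrightarrow>
        ((\<lambda>u. f (slice_pt J u y)) has_vector_derivative fx (slice_pt J x y)) (at x) \<and>
        ((\<lambda>v. f (slice_pt J x v)) has_vector_derivative fy (slice_pt J x y)) (at y) \<and>
        (1 / 2) * (fx (slice_pt J x y) + J * fy (slice_pt J x y)) = 0))"

definition slice_regular_on :: "quat set \<Rightarrow> (quat \<Rightarrow> quat) \<Rightarrow> bool" where
  "slice_regular_on \<Omega> f \<longleftrightarrow> (\<forall>J\<in>\<S>. slice_holomorphic_on J (\<Omega> \<inter> slice_plane J) f)"

definition symmetric_completion :: "quat set \<Rightarrow> quat set" where
  "symmetric_completion \<Omega> =
    (\<Union>(x, y) \<in> {(x, y). \<exists>J\<in>\<S>. slice_pt J x y \<in> \<Omega>}. {slice_pt K x y | K. K \<in> \<S>})"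


section \<open>The construction\<close>

definition \<gamma>_end :: "quat \<Rightarrow> nat \<Rightarrow> real \<Rightarrow> quat" where
  "\<gamma>_end I i t =
    (if t \<le> 1 / 2 then - 1 + 2 * I + exp (((- 1) ^ i * 2 * pi * t) *\<^sub>R I)
     else 2 * I - of_real (inverse (1 - t)))"

definition \<gamma>_curve :: "quat \<Rightarrow> real \<Rightarrow> real \<Rightarrow> quat" where
  "\<gamma>_curve I s t = (1 - s) *\<^sub>R \<gamma>_end I 0 t + s *\<^sub>R \<gamma>_end I 1 t"

definition \<gamma>_img :: "quat \<Rightarrow> real \<Rightarrow> quat set" where
  "\<gamma>_img I s = \<gamma>_curve I s ` {0..<1}"

definition is_log_extension :: "quat \<Rightarrow> real \<Rightarrow> (quat \<Rightarrow> quat) \<Rightarrow> bool" where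
  "is_log_extension I t f \<longleftrightarrow>
    slice_holomorphic_on I (slice_plane I - \<gamma>_img I t) f \<and>
    f ` (slice_plane I - \<gamma>_img I t) \<subseteq> slice_plane I \<and>
    (\<forall>x>0. f (of_real x + 2 * I) = of_real (ln x))"

text \<open>Unique on \<open>slice_plane I - \<gamma>_img I t\<close>, which is connected; the choice only affects
  values outside this set.\<close>

definition log_ext :: "quat \<Rightarrow> real \<Rightarrow> quat \<Rightarrow> quat" where
  "log_ext I t = (SOME f. is_log_extension I t f)"

definition T_param :: "quat \<Rightarrow> quat \<Rightarrow> real" where
  "T_param I J = min (norm (J - I)) 1"

definition half_plane :: "quat \<Rightarrow> quat set" where
  "half_plane J = {slice_pt J x y | x y. 0 \<le> y}"

text \<open>For \<open>z = x + y I\<close> with \<open>I \<in> \<S>\<close> one has \<open>x = qre z\<close> and \<open>y = I \<bullet> z\<close>.\<close>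

definition slice_proj :: "quat \<Rightarrow> quat \<Rightarrow> quat \<Rightarrow> quat" where
  "slice_proj I J z = slice_pt J (qre z) (I \<bullet> z)"

definition U_plus :: "quat \<Rightarrow> quat \<Rightarrow> quat set" where
  "U_plus I J = half_plane J - slice_proj I J ` \<gamma>_img I (T_param I J)"

definition F_plus :: "quat \<Rightarrow> quat \<Rightarrow> quat \<Rightarrow> quat" where
  "F_plus I J q = (let x = qre q; y = J \<bullet> q; f = log_ext I (T_param I J) in
    (1 - J * I) / 2 * f (slice_pt I x y) + (1 + J * I) / 2 * f (slice_pt I x (- y)))"

definition \<Omega>_dom :: "quat \<Rightarrow> quat set" where
  "\<Omega>_dom I = (\<Union>J\<in>\<S>. U_plus I J)"

lemma slice_proj_slice_pt:
  assumes "I \<in> \<S>"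
  shows "slice_proj I J (slice_pt I x y) = slice_pt J x y"
proof -
  have sq: "qre I * qre I - qi I * qi I - qj I * qj I - qk I * qk I = - 1"
    "qre I * qi I = 0" "qre I * qj I = 0" "qre I * qk I = 0"
    using assms
    by (auto simp: imag_units_def power2_eq_square times_quat_def one_quat_def quat_eq_iff)
  have "qre I = 0"
  proof (rule ccontr)
    assume "qre I \<noteq> 0"
    with sq have "qre I * qre I = - 1" by simp
    then show False by (metis zero_le_square neg_0_le_iff_le not_one_le_zero)
  qed
  with sq(1) have "I \<bullet> I = 1"
    by (simp add: inner_quat_def)
  moreover have "qre (of_real r) = r" "I \<bullet> of_real r = 0" for r
    using \<open>qre I = 0\<close> by (simp_all add: of_real_def one_quat_def inner_quat_def)
  ultimately show ?thesis
    using \<open>qre I = 0\<close> by (simp add: slice_proj_def slice_pt_def inner_add_right)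
qed

end

(*
  The parts gamma_0 and gamma_1 of the two cuts inside the disc |z - 2I| < 2 meet only in 2I, so the
  points of C_I in the punctured disc all lie in the completion: use J = I or J = -I. The
  C_I-component of an extension of G is holomorphic there and equals ln x at x + 2I for x > 0, hence
  by the identity theorem it is a logarithm of z - 2I on a punctured disc, which is impossible.
*)

theory Submission
  imports Defs "HOL-Complex_Analysis.Complex_Analysis"
begin

section \<open>Holomorphy from continuous partial derivatives\<close>

text \<open>Existence of one partial derivative and continuity of the other give a total real
  derivative; the Cauchy-Riemann equation then makes it complex linear.\<close>

lemma has_field_derivative_from_partials:
  fixes h hx hy :: "complex \<Rightarrow> complex"
  assumes "open S" "z \<in> S" and cont: "continuous_on S hy"
    and dx: "\<And>w. w \<in> S \<Longrightarrow> ((\<lambda>u. h (Complex u (Im w))) has_vector_derivative hx w) (at (Re w))"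
    and dy: "\<And>w. w \<in> S \<Longrightarrow> ((\<lambda>v. h (Complex (Re w) v)) has_vector_derivative hy w) (at (Im w))"
    and cr: "\<And>w. w \<in> S \<Longrightarrow> hx w + \<i> * hy w = 0"
  shows "(h has_field_derivative hx z) (at z)"
proof -
  obtain e where "e > 0" and e: "ball z e \<subseteq> S"
    using assms(1,2) openE by blast
  \<comment> \<open>A square of half side \<open>e / 2\<close> fits into the ball; its product form
    allows differentiating in one variable at a time.\<close>
  define X where "X = ball (Re z) (e / 2)"
  define Y where "Y = ball (Im z) (e / 2)"
  have XY: "Complex x y \<in> S" if "x \<in> X" "y \<in> Y" for x y
  proof -
    have "dist z (Complex x y) \<le> \<bar>Re (z - Complex x y)\<bar> + \<bar>Im (z - Complex x y)\<bar>"
      unfolding dist_norm by (rule cmod_le)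
    also have "\<dots> < e / 2 + e / 2"
      using that by (intro add_strict_mono) (auto simp: X_def Y_def dist_real_def)
    finally show ?thesis using e by auto
  qed
  have mem: "Re z \<in> X" "Im z \<in> Y" and op: "open X" "open Y"
    using \<open>e > 0\<close> by (auto simp: X_def Y_def)
  have contc: "continuous_on (X \<times> Y) (\<lambda>(x, y). hy (Complex x y))"
  proof -
    have "continuous_on (X \<times> Y) (\<lambda>p. Complex (fst p) (snd p))"
      unfolding Complex_eq by (intro continuous_intros)
    then show ?thesis
      unfolding split_beta by (rule continuous_on_compose2[OF cont]) (auto intro: XY)
  qed
  have "((\<lambda>(x, y). h (Complex x y)) has_derivative
      (\<lambda>(tx, ty). tx *\<^sub>R hx z + blinfun_apply (blinfun_scaleR_left (hy (Complex (Re z) (Im z)))) ty))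
      (at (Re z, Im z) within X \<times> Y)"
  proof (rule has_derivative_partialsI[where fy = "\<lambda>x y. blinfun_scaleR_left (hy (Complex x y))"])
    show "((\<lambda>x. h (Complex x (Im z))) has_derivative (\<lambda>tx. tx *\<^sub>R hx z)) (at (Re z) within X)"
      using dx[OF \<open>z \<in> S\<close>] unfolding has_vector_derivative_def
      by (rule has_derivative_at_withinI)
    show "((\<lambda>y. h (Complex x y)) has_derivative blinfun_apply (blinfun_scaleR_left (hy (Complex x y))))
        (at y within Y)" if "x \<in> X" "y \<in> Y" for x y
      using dy[OF XY[OF that]] unfolding has_vector_derivative_def
      by (auto intro: has_derivative_at_withinI)
    show "continuous (at (Re z, Im z) within X \<times> Y)
        (\<lambda>(x, y). blinfun_scaleR_left (hy (Complex x y)))"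
    proof -
      have "continuous_on (X \<times> Y) (\<lambda>p. blinfun_scaleR_left (case p of (x, y) \<Rightarrow> hy (Complex x y)))"
        by (rule bounded_linear.continuous_on[OF bounded_linear_blinfun_scaleR_left contc])
      then show ?thesis
        using mem unfolding continuous_on_eq_continuous_within split_beta by fastforce
    qed
    show "convex Y" by (simp add: Y_def)
  qed (use mem in auto)
  then have der: "((\<lambda>(x, y). h (Complex x y)) has_derivative (\<lambda>(tx, ty). tx *\<^sub>R hx z + ty *\<^sub>R hy z))
      (at (Re z, Im z))"
    using at_within_open[of "(Re z, Im z)" "X \<times> Y"] mem op by (simp add: open_Times)
  have "((\<lambda>w. (Re w, Im w)) has_derivative (\<lambda>w. (Re w, Im w))) (at z)"
    by (auto intro!: derivative_eq_intros)
  from has_derivative_compose[OF this der]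
  have "(h has_derivative (\<lambda>w. Re w *\<^sub>R hx z + Im w *\<^sub>R hy z)) (at z)"
    by simp
  \<comment> \<open>Since \<open>hy z\<close> is \<open>\<i> * hx z\<close>, the real differential
    is multiplication by \<open>hx z\<close>.\<close>
  moreover have "hx z = - (\<i> * hy z)"
    using cr[OF \<open>z \<in> S\<close>] by (simp add: eq_neg_iff_add_eq_0)
  then have "Re w *\<^sub>R hx z + Im w *\<^sub>R hy z = hx z * w" for w
    by (simp add: complex_eq_iff algebra_simps)
  ultimately show ?thesis
    by (simp add: has_field_derivative_def)
qed

text \<open>By the identity theorem \<open>exp (h w) = w\<close> spreads from the real segment to
  the punctured ball. So \<open>h\<close> is a primitive of \<open>1 / w\<close> there, although the
  integral of \<open>1 / w\<close> around a circle is not 0.\<close>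

lemma no_log_on_punctured_ball:
  assumes "0 < r" and "h holomorphic_on ball 0 r - {0}"
    and ln: "\<And>x. 0 < x \<Longrightarrow> x < r \<Longrightarrow> h (of_real x) = of_real (ln x)"
  shows False
proof -
  define A where "A = ball (0::complex) r - {0}"
  have op: "open A" and conn: "connected A"
    by (auto simp: A_def intro!: connected_punctured_ball)
  have exph: "exp (h w) = w" if "w \<in> A" for w
  proof -
    define U where "U = complex_of_real ` {0<..<r}"
    have rA: "complex_of_real (r / 2) \<in> A"
      using \<open>0 < r\<close> by (auto simp: A_def norm_divide)
    \<comment> \<open>The identity theorem asks for a limit point inside \<open>A\<close>; as 0 is
      removed, the midpoint of the segment serves.\<close>
    have "r / 2 islimpt {0<..<r}"
      using \<open>0 < r\<close> by (intro open_imp_islimpt) auto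
    then have lim: "complex_of_real (r / 2) islimpt U"
      unfolding U_def by (rule islimpt_isCont_image) (simp_all add: eventually_at_filter del: of_real_divide)
    have "exp (h w) - w = 0"
      by (rule analytic_continuation[OF _ op conn _ rA lim _ that])
        (use assms in \<open>auto simp: A_def U_def exp_of_real intro!: holomorphic_intros\<close>)
    then show ?thesis by simp
  qed
  have der: "(h has_field_derivative 1 / w) (at w within A)" if "w \<in> A" for w
  proof -
    have h: "(h has_field_derivative deriv h w) (at w)"
      using assms(2) op that holomorphic_derivI unfolding A_def by blast
    have "((\<lambda>w. exp (h w)) has_field_derivative exp (h w) * deriv h w) (at w)"
      using h by (auto intro!: derivative_eq_intros)
    moreover have "((\<lambda>w. exp (h w)) has_field_derivative 1) (at w)"
      by (rule has_field_derivative_transform_within_open[OF DERIV_ident op that]) (simp add: exph)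
    ultimately have "w * deriv h w = 1"
      using DERIV_unique exph[OF that] by metis
    then have "deriv h w = 1 / w"
      using that by (auto simp: A_def field_simps)
    then show ?thesis
      using h by (auto intro: has_field_derivative_at_within)
  qed
  have "((\<lambda>w. 1 / w) has_contour_integral
      (h (pathfinish (circlepath 0 (r / 2))) - h (pathstart (circlepath 0 (r / 2))))) (circlepath 0 (r / 2))"
    using \<open>0 < r\<close> by (intro contour_integral_primitive[OF der]) (auto simp: A_def)
  then have "contour_integral (circlepath 0 (r / 2)) (\<lambda>w. 1 / w) = 0"
    by (simp add: contour_integral_unique)
  then show False
    using contour_integral_circlepath[of "r / 2" 0] \<open>0 < r\<close> by simp
qed


section \<open>A slice plane as a copy of the complex numbers\<close>

lemma imag_unitD:
  assumes "J \<in> \<S>"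
  shows "qre J = 0" and "J * J = - 1" and "J \<bullet> J = 1" and "norm J = 1"
proof -
  show JJ: "J * J = - 1"
    using assms by (simp add: imag_units_def power2_eq_square)
  show "J \<bullet> J = 1"
  proof -
    have "norm J * norm J = 1"
      using JJ norm_mult[of J J] by simp
    then show ?thesis by (simp add: norm_quat_def)
  qed
  then show "norm J = 1" by (simp add: norm_quat_def)
  \<comment> \<open>Adding the real part of \<open>J * J = - 1\<close> to
    \<open>J \<bullet> J = 1\<close> leaves twice the square of \<open>qre J\<close> equal to
    0.\<close>
  from JJ \<open>J \<bullet> J = 1\<close> show "qre J = 0"
    by (auto simp: times_quat_def one_quat_def quat_eq_iff inner_quat_def)
qed

lemma uminus_imag_unit: "J \<in> \<S> \<Longrightarrow> - J \<in> \<S>"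
  by (simp add: imag_units_def)

definition slice_emb :: "quat \<Rightarrow> complex \<Rightarrow> quat" where
  "slice_emb J z = slice_pt J (Re z) (Im z)"

text \<open>For \<open>J\<close> in \<open>\<S>\<close> this is the orthogonal projection of all
  quaternions onto \<open>slice_plane J\<close>, read in complex coordinates. It also applies to
  function values off that plane.\<close>

definition slice_coord :: "quat \<Rightarrow> quat \<Rightarrow> complex" where
  "slice_coord J q = Complex (qre q) (J \<bullet> q)"

lemma quat_of_real_simps [simp]:
  "qre (of_real r) = r" "qi (of_real r) = 0" "qj (of_real r) = 0" "qk (of_real r) = 0"
  by (simp_all add: of_real_def one_quat_def)

lemma slice_coord_slice_pt:
  assumes "J \<in> \<S>"
  shows "slice_coord J (slice_pt J x y) = Complex x y"
proof -
  have "J \<bullet> of_real x = 0"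
    using imag_unitD(1)[OF assms] by (simp add: inner_quat_def)
  then show ?thesis
    using imag_unitD(1,3)[OF assms]
    by (simp add: slice_coord_def slice_pt_def inner_add_right)
qed

lemma slice_coord_slice_emb: "J \<in> \<S> \<Longrightarrow> slice_coord J (slice_emb J z) = z"
  by (simp add: slice_emb_def slice_coord_slice_pt)

lemma slice_pt_eq_iff:
  assumes "J \<in> \<S>"
  shows "slice_pt J x y = slice_pt J x' y' \<longleftrightarrow> x = x' \<and> y = y'"
  using slice_coord_slice_pt[OF assms] by (metis complex.inject)

lemma bounded_linear_slice_emb: "bounded_linear (slice_emb J)"
  unfolding slice_emb_def slice_pt_def
  by (intro bounded_linear_add bounded_linear_compose[OF bounded_linear_of_real]
      bounded_linear_compose[OF bounded_linear_scaleR_left] bounded_linear_Re bounded_linear_Im)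

lemma bounded_linear_slice_coord: "bounded_linear (slice_coord J)"
proof -
  have "linear (slice_coord J)"
    by (rule linearI) (auto simp: slice_coord_def complex_eq_iff inner_add_right)
  then show ?thesis by (simp add: linear_conv_bounded_linear)
qed

text \<open>The projection onto \<open>slice_plane J\<close> commutes with left multiplication by \<open>J\<close>, so it
  preserves left holomorphy.\<close>

lemma slice_coord_mult_unit:
  assumes "J \<in> \<S>"
  shows "slice_coord J (J * q) = \<i> * slice_coord J q"
proof -
  have 0: "qre J = 0" and 1: "J \<bullet> J = 1"
    using imag_unitD[OF assms] by auto
  have "J \<bullet> (J * q) = (J \<bullet> J) * qre q"
    using 0 by (simp add: inner_quat_def times_quat_def algebra_simps)
  then show ?thesis
    using 0 1 by (simp add: slice_coord_def complex_eq_iff times_quat_def inner_quat_def)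
qed

lemma slice_emb_mult:
  assumes "J \<in> \<S>"
  shows "slice_emb J (z * w) = slice_emb J z * slice_emb J w"
proof -
  have "slice_emb J z * slice_emb J w =
      of_real (Re z * Re w) + (Re z * Im w + Im z * Re w) *\<^sub>R J + (Im z * Im w) *\<^sub>R (J * J)"
    by (simp add: slice_emb_def slice_pt_def of_real_def algebra_simps scaleR_add_left)
  also have "\<dots> = slice_emb J (z * w)"
    using imag_unitD(2)[OF assms]
    by (simp add: slice_emb_def slice_pt_def of_real_def algebra_simps scaleR_add_left)
  finally show ?thesis ..
qed

lemma slice_emb_1 [simp]: "slice_emb J 1 = 1"
  and slice_emb_ii [simp]: "slice_emb J \<i> = J"
  and slice_emb_of_real [simp]: "slice_emb J (of_real r) = of_real r"
  by (simp_all add: slice_emb_def slice_pt_def)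

text \<open>A continuous linear map that is multiplicative carries the exponential series over term
  by term.\<close>

lemma slice_emb_exp:
  assumes "J \<in> \<S>"
  shows "slice_emb J (exp z) = exp (slice_emb J z)"
proof -
  have "slice_emb J (z ^ n) = slice_emb J z ^ n" for n
    by (induction n) (simp_all add: slice_emb_mult[OF assms])
  moreover have "(\<lambda>n. slice_emb J (z ^ n /\<^sub>R fact n)) sums slice_emb J (exp z)"
    by (intro bounded_linear.sums[OF bounded_linear_slice_emb] exp_converges)
  ultimately have "(\<lambda>n. slice_emb J z ^ n /\<^sub>R fact n) sums slice_emb J (exp z)"
    by (simp add: linear_cmul[OF bounded_linear.linear[OF bounded_linear_slice_emb]])
  then show ?thesis
    using exp_converges sums_unique2 by blast
qed

lemma exp_scaleR_imag_unit:
  assumes "J \<in> \<S>"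
  shows "exp (r *\<^sub>R J) = slice_pt J (cos r) (sin r)"
proof -
  have "r *\<^sub>R J = slice_emb J (\<i> * of_real r)"
    by (simp add: slice_emb_def slice_pt_def)
  then show ?thesis
    using slice_emb_exp[OF assms, of "\<i> * of_real r"]
    by (simp add: slice_emb_def cis_conv_exp[symmetric])
qed

lemma slice_pt_arith:
  "slice_pt J x y + slice_pt J x' y' = slice_pt J (x + x') (y + y')"
  "slice_pt J x y - slice_pt J x' y' = slice_pt J (x - x') (y - y')"
  "r *\<^sub>R slice_pt J x y = slice_pt J (r * x) (r * y)"
  "- slice_pt J x y = slice_pt J (- x) (- y)"
  by (simp_all add: slice_pt_def algebra_simps of_real_def)

lemma slice_pt_const:
  "of_real x = slice_pt J x 0" "1 = slice_pt J 1 0" "2 * J = slice_pt J 0 2"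
  "of_real x + 2 * J = slice_pt J x 2"
  by (simp_all add: slice_pt_def scaleR_2 mult_2)

text \<open>Projecting both partial derivatives turns left multiplication by \<open>J\<close> into
  multiplication by \<open>\<i>\<close>, hence the quaternionic equation into the Cauchy-Riemann
  equation.\<close>

lemma slice_holomorphic_coord:
  assumes J: "J \<in> \<S>" and f: "slice_holomorphic_on J D f" and "open S"
    and S: "slice_emb J ` S \<subseteq> D"
  shows "(\<lambda>w. slice_coord J (f (slice_emb J w))) holomorphic_on S"
proof -
  obtain fx fy where fy: "continuous_on D fy"
    and d: "\<And>x y. slice_pt J x y \<in> D \<Longrightarrow>
        ((\<lambda>u. f (slice_pt J u y)) has_vector_derivative fx (slice_pt J x y)) (at x) \<and>
        ((\<lambda>v. f (slice_pt J x v)) has_vector_derivative fy (slice_pt J x y)) (at y) \<and>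
        (1 / 2) * (fx (slice_pt J x y) + J * fy (slice_pt J x y)) = 0"
    using f unfolding slice_holomorphic_on_def by blast
  note bl = bounded_linear_slice_coord[of J]
  have "((\<lambda>w. slice_coord J (f (slice_emb J w))) has_field_derivative
      slice_coord J (fx (slice_emb J z))) (at z)" if "z \<in> S" for z
  proof (rule has_field_derivative_from_partials[OF \<open>open S\<close> that,
        where hy = "\<lambda>w. slice_coord J (fy (slice_emb J w))"])
    show "continuous_on S (\<lambda>w. slice_coord J (fy (slice_emb J w)))"
      by (intro bounded_linear.continuous_on[OF bl] continuous_on_compose2[OF fy]
          bounded_linear.continuous_on[OF bounded_linear_slice_emb] continuous_intros S)
  next
    fix w assume "w \<in> S"
    with S have "slice_pt J (Re w) (Im w) \<in> D"
      by (auto simp: slice_emb_def)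
    note dw = d[OF this]
    show "((\<lambda>u. slice_coord J (f (slice_emb J (Complex u (Im w))))) has_vector_derivative
        slice_coord J (fx (slice_emb J w))) (at (Re w))"
      and "((\<lambda>v. slice_coord J (f (slice_emb J (Complex (Re w) v)))) has_vector_derivative
        slice_coord J (fy (slice_emb J w))) (at (Im w))"
      using dw by (auto intro!: bounded_linear.has_vector_derivative[OF bl] simp: slice_emb_def)
    have "fx (slice_emb J w) + J * fy (slice_emb J w) = 0"
      using dw by (simp add: slice_emb_def)
    then show "slice_coord J (fx (slice_emb J w)) + \<i> * slice_coord J (fy (slice_emb J w)) = 0"
      using linear_add[OF bounded_linear.linear[OF bl]] linear_0[OF bounded_linear.linear[OF bl]]
      by (metis slice_coord_mult_unit[OF J])
  qed
  then show ?thesis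
    using \<open>open S\<close> holomorphic_on_open by blast
qed


section \<open>The curves and the logarithm\<close>

text \<open>The two end curves differ only in the sign of the sine, so interpolation scales it by
  \<open>(1 - s) - s\<close>; their straight tails coincide.\<close>

lemma \<gamma>_curve_eq:
  assumes "I \<in> \<S>"
  shows "\<gamma>_curve I s t =
    (if t \<le> 1 / 2 then slice_pt I (cos (2 * pi * t) - 1) (2 + (1 - 2 * s) * sin (2 * pi * t))
     else slice_pt I (- inverse (1 - t)) 2)"
proof -
  have "exp (((- 1) ^ i * 2 * pi * t) *\<^sub>R I) = slice_pt I (cos (2 * pi * t)) ((- 1) ^ i * sin (2 * pi * t))"
    for i
    by (cases "even i") (simp_all add: exp_scaleR_imag_unit[OF assms] flip: scaleR_minus_left)
  then have "\<gamma>_end I i t = (if t \<le> 1 / 2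
      then slice_pt I (cos (2 * pi * t) - 1) (2 + (- 1) ^ i * sin (2 * pi * t))
      else slice_pt I (- inverse (1 - t)) 2)" for i
    by (simp add: \<gamma>_end_def slice_pt_const(1,3)[where J = I] slice_pt_const(2)[of I]
        slice_pt_arith)
  then show ?thesis
    by (simp add: \<gamma>_curve_def slice_pt_arith slice_pt_eq_iff[OF assms]) (simp add: algebra_simps)
qed

text \<open>This is \<open>\<gamma>_img I 0\<close> in the coordinate
  \<open>w = z - 2 * \<i>\<close>: an upper half circle from 0 to -2, followed by a ray.\<close>

definition log_cut :: "complex set" where
  "log_cut = {w. cmod (w + 1) = 1 \<and> 0 \<le> Im w \<or> Re w \<le> - 2 \<and> Im w = 0}"

text \<open>The branch of the logarithm off \<open>log_cut\<close>: crossing the negative axis inside the unit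
  disc about \<open>- 1\<close> no longer changes it.\<close>

definition bent_Ln :: "complex \<Rightarrow> complex" where
  "bent_Ln w = (if cmod (w + 1) < 1 then Ln (- w) - \<i> * pi else Ln w)"

text \<open>Below the real axis \<open>Ln (- w)\<close> is \<open>Ln w + \<i> * pi\<close>, so the
  two formulas agree and glue across the lower half circle.\<close>

lemma bent_Ln_lower:
  assumes "Im w < 0"
  shows "bent_Ln w = Ln w"
proof -
  have "w \<noteq> 0" using assms by auto
  with assms show ?thesis
    using Ln_minus[of w] by (simp add: bent_Ln_def)
qed

text \<open>Both formulas have derivative \<open>1 / w\<close>, so only their domains matter. The
  open disc about -1 lies in the left half plane, where \<open>Ln (- w)\<close> is
  holomorphic.\<close>

lemma has_field_derivative_bent_Ln:
  assumes "w \<notin> log_cut"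
  shows "(bent_Ln has_field_derivative 1 / w) (at w)"
proof -
  consider "cmod (w + 1) < 1" | "cmod (w + 1) > 1" | "cmod (w + 1) = 1" by linarith
  then show ?thesis
  proof cases
    case 1
    then have "Re w < 0"
      using abs_Re_le_cmod[of "w + 1"] by simp
    then have "- w \<notin> \<real>\<^sub>\<le>\<^sub>0" "w \<noteq> 0"
      by (auto simp: complex_nonpos_Reals_iff)
    then have "((\<lambda>w. Ln (- w) - \<i> * pi) has_field_derivative 1 / w) (at w)"
      by (auto intro!: derivative_eq_intros simp: field_simps)
    moreover have "open {w. cmod (w + 1) < 1}"
      by (intro open_Collect_less continuous_intros)
    ultimately show ?thesis
      by (rule has_field_derivative_transform_within_open) (use 1 in \<open>auto simp: bent_Ln_def\<close>)
  next
    case 2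
    \<comment> \<open>A nonpositive real outside the closed disc is less than -2 and so lies on the
      ray of \<open>log_cut\<close>.\<close>
    have "w \<notin> \<real>\<^sub>\<le>\<^sub>0"
    proof
      assume "w \<in> \<real>\<^sub>\<le>\<^sub>0"
      then have "Im w = 0" "Re w \<le> 0"
        by (auto simp: complex_nonpos_Reals_iff)
      moreover from this have "cmod (w + 1) = \<bar>Re w + 1\<bar>"
        by (simp add: cmod_def)
      ultimately show False
        using 2 assms by (auto simp: log_cut_def)
    qed
    then have "(Ln has_field_derivative 1 / w) (at w)"
      using has_field_derivative_Ln by (simp add: inverse_eq_divide)
    moreover have "open {w. cmod (w + 1) > 1}"
      by (intro open_Collect_less continuous_intros)
    ultimately show ?thesis
      by (rule has_field_derivative_transform_within_open) (use 2 in \<open>auto simp: bent_Ln_def\<close>)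
  next
    case 3
    \<comment> \<open>Off \<open>log_cut\<close> only the open lower arc of the circle
      remains.\<close>
    with assms have neg: "Im w < 0" by (auto simp: log_cut_def)
    then have "(Ln has_field_derivative 1 / w) (at w)"
      using has_field_derivative_Ln[of w] by (auto simp: inverse_eq_divide complex_nonpos_Reals_iff)
    then show ?thesis
      by (rule has_field_derivative_transform_within_open[OF _ open_halfspace_Im_lt[of 0]])
        (use neg bent_Ln_lower in auto)
  qed
qed

text \<open>The angle is \<open>2 * pi * t\<close>. The value \<open>t = 1 / 2\<close> belongs to
  the arc, whence the strict bound on the ray.\<close>

lemma \<gamma>_img_cases:
  assumes "I \<in> \<S>" and "slice_pt I x y \<in> \<gamma>_img I s"
  obtains \<theta> where "0 \<le> \<theta>" "\<theta> \<le> pi" "x = cos \<theta> - 1" "y = 2 + (1 - 2 * s) * sin \<theta>"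
  | "x < - 2" "y = 2"
proof -
  obtain t where t: "0 \<le> t" "t < 1" and eq: "slice_pt I x y = \<gamma>_curve I s t"
    using assms(2) by (auto simp: \<gamma>_img_def)
  show ?thesis
  proof (cases "t \<le> 1 / 2")
    case True
    then have "pi * t \<le> pi * (1 / 2)" by (intro mult_left_mono) auto
    with True show ?thesis
      using eq t by (intro that(1)[of "2 * pi * t"])
        (auto simp: \<gamma>_curve_eq[OF assms(1)] slice_pt_eq_iff[OF assms(1)])
  next
    case False
    then have "inverse (1 - t) > 2"
      using t by (simp add: field_simps)
    with False show ?thesis
      using eq by (intro that(2))
        (auto simp: \<gamma>_curve_eq[OF assms(1)] slice_pt_eq_iff[OF assms(1)])
  qed
qed

text \<open>Hence \<open>bent_Ln\<close>, shifted to \<open>2 * \<i>\<close>, is differentiable off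
  the curve. The parameters come from solving the formula for \<open>\<gamma>_curve\<close> for
  \<open>t\<close>.\<close>

lemma log_cut_subset_\<gamma>_img:
  assumes "I \<in> \<S>" and "Complex x (y - 2) \<in> log_cut"
  shows "slice_pt I x y \<in> \<gamma>_img I 0"
proof (cases "cmod (Complex x (y - 2) + 1) = 1 \<and> 2 \<le> y")
  case True
  then have circ: "(x + 1)\<^sup>2 + (y - 2)\<^sup>2 = 1"
    by (simp add: cmod_def)
  have bd: "\<bar>x + 1\<bar> \<le> 1"
    using circ by (metis abs_le_square_iff abs_one le_add_same_cancel1 one_power2 zero_le_power2)
  define \<theta> where "\<theta> = arccos (x + 1)"
  \<comment> \<open>On the upper arc \<open>y - 2\<close> is the nonnegative root, which is the sine
    of an arccosine.\<close>
  have "y - 2 = sqrt (1 - (x + 1)\<^sup>2)"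
    using circ True by (intro real_sqrt_unique[symmetric]) auto
  then have \<theta>: "0 \<le> \<theta>" "\<theta> \<le> pi" "cos \<theta> = x + 1" "sin \<theta> = y - 2"
    using bd by (auto simp: \<theta>_def abs_le_iff arccos_lbound arccos_ubound sin_arccos_abs)
  then have "\<theta> < 2 * pi"
    using pi_gt_zero by linarith
  from \<theta> have "slice_pt I x y = \<gamma>_curve I 0 (\<theta> / (2 * pi))"
    by (simp add: \<gamma>_curve_eq[OF assms(1)])
  then show ?thesis
    using \<theta> \<open>\<theta> < 2 * pi\<close> unfolding \<gamma>_img_def by (intro image_eqI[of _ _ "\<theta> / (2 * pi)"]) auto
next
  case False
  with assms(2) have xy: "x \<le> - 2" "y = 2"
    by (auto simp: log_cut_def)
  \<comment> \<open>The point -2 lies on the circle and falls under the first case; for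
    \<open>x < - 2\<close> the parameter \<open>1 + 1 / x\<close> exceeds
    \<open>1 / 2\<close>.\<close>
  with False have "x \<noteq> - 2" by (auto simp: cmod_def)
  with xy have x: "x < - 2" by simp
  then have "slice_pt I x y = \<gamma>_curve I 0 (1 + 1 / x)"
    using xy by (auto simp: \<gamma>_curve_eq[OF assms(1)] slice_pt_eq_iff[OF assms(1)] field_simps)
  then show ?thesis
    using x unfolding \<gamma>_img_def
    by (intro image_eqI[of _ _ "1 + 1 / x"]) (auto simp: field_simps)
qed

text \<open>The bound on \<open>Re w\<close> excludes the rays. The sine is nonnegative on one arc
  and enters negated on the other, so a common point is real, that is 0 or -2, and both are outside
  the punctured disc.\<close>

lemma not_in_both_\<gamma>_img:
  assumes I: "I \<in> \<S>" and "w \<in> ball 0 2 - {0}"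
  shows "slice_pt I (Re w) (Im w + 2) \<notin> \<gamma>_img I 0 \<or> slice_pt I (Re w) (Im w + 2) \<notin> \<gamma>_img I 1"
proof (rule ccontr)
  assume "\<not> ?thesis"
  then have g0: "slice_pt I (Re w) (Im w + 2) \<in> \<gamma>_img I 0"
    and g1: "slice_pt I (Re w) (Im w + 2) \<in> \<gamma>_img I 1" by auto
  have "\<bar>Re w\<bar> < 2"
    using assms(2) abs_Re_le_cmod[of w] by auto
  obtain a where a: "0 \<le> a" "a \<le> pi" "Re w = cos a - 1" "Im w = sin a"
    by (rule \<gamma>_img_cases[OF I g0]) (use \<open>\<bar>Re w\<bar> < 2\<close> in auto)
  obtain b where b: "0 \<le> b" "b \<le> pi" "Im w = - sin b"
    by (rule \<gamma>_img_cases[OF I g1]) (use \<open>\<bar>Re w\<bar> < 2\<close> in auto)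
  then have "Im w = 0"
    using a sin_ge_zero[of a] sin_ge_zero[of b] by linarith
  moreover from this a have "(Re w + 1)\<^sup>2 = 1"
    using sin_cos_squared_add[of a] by simp
  then have "Re w = 0 \<or> Re w = - 2"
    by (auto simp: power2_eq_1_iff)
  ultimately show False
    using assms(2) \<open>\<bar>Re w\<bar> < 2\<close> by (auto simp: complex_eq_iff)
qed

text \<open>The transfer from complex functions back to the slice: the partial derivatives are the
  images of \<open>F'\<close> and \<open>\<i> * F'\<close>, and \<open>J * J = - 1\<close> makes
  them satisfy the equation.\<close>

lemma slice_holomorphic_on_complex:
  assumes J: "J \<in> \<S>" and F: "\<And>z. z \<in> A \<Longrightarrow> (F has_field_derivative F' z) (at z)"
    and cont: "continuous_on A F'" and D: "D \<subseteq> slice_emb J ` A"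
  shows "slice_holomorphic_on J D (\<lambda>q. slice_emb J (F (slice_coord J q)))"
  unfolding slice_holomorphic_on_def
proof (intro exI conjI allI impI)
  note bl = bounded_linear_slice_emb[of J]
  have coord: "slice_coord J ` D \<subseteq> A"
    using D by (auto simp: slice_coord_slice_emb[OF J])
  have contF: "continuous_on D (\<lambda>q. F' (slice_coord J q))"
    by (rule continuous_on_compose2[OF cont _ coord])
      (intro bounded_linear.continuous_on[OF bounded_linear_slice_coord] continuous_intros)
  then show "continuous_on D (\<lambda>q. slice_emb J (F' (slice_coord J q)))"
    and "continuous_on D (\<lambda>q. slice_emb J (\<i> * F' (slice_coord J q)))"
    by (intro bounded_linear.continuous_on[OF bl] continuous_intros; simp)+
  fix x y assume "slice_pt J x y \<in> D"
  then have z: "Complex x y \<in> A"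
    using coord slice_coord_slice_pt[OF J] by (metis image_subset_iff)
  have "((\<lambda>u. Complex u y) has_vector_derivative 1) (at x)"
    unfolding Complex_eq by (auto intro!: derivative_eq_intros)
  from field_vector_diff_chain_at[OF this F[OF z]]
  show "((\<lambda>u. slice_emb J (F (slice_coord J (slice_pt J u y)))) has_vector_derivative
      slice_emb J (F' (slice_coord J (slice_pt J x y)))) (at x)"
    by (intro bounded_linear.has_vector_derivative[OF bl])
      (simp add: slice_coord_slice_pt[OF J] o_def)
  have "((\<lambda>v. Complex x v) has_vector_derivative \<i>) (at y)"
    unfolding Complex_eq by (auto intro!: derivative_eq_intros)
  from field_vector_diff_chain_at[OF this F[OF z]]
  show "((\<lambda>v. slice_emb J (F (slice_coord J (slice_pt J x v)))) has_vector_derivative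
      slice_emb J (\<i> * F' (slice_coord J (slice_pt J x y)))) (at y)"
    by (intro bounded_linear.has_vector_derivative[OF bl])
      (simp add: slice_coord_slice_pt[OF J] o_def)
  show "1 / 2 * (slice_emb J (F' (slice_coord J (slice_pt J x y))) +
      J * slice_emb J (\<i> * F' (slice_coord J (slice_pt J x y)))) = 0"
    using imag_unitD(2)[OF J] by (simp add: slice_emb_mult[OF J] mult.assoc[symmetric])
qed

text \<open>As \<open>log_ext\<close> is a choice, some extension has to be exhibited:
  \<open>bent_Ln\<close> shifted to \<open>2 * \<i>\<close>.\<close>

lemma is_log_extension_log_ext_0:
  assumes I: "I \<in> \<S>"
  shows "is_log_extension I 0 (log_ext I 0)"
proof -
  define A where "A = {z. z - 2 * \<i> \<notin> log_cut}"
  define f where "f = (\<lambda>q. slice_emb I (bent_Ln (slice_coord I q - 2 * \<i>)))"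
  have shift: "z - 2 * \<i> = Complex (Re z) (Im z - 2)" for z
    by (simp add: complex_eq_iff)
  have "slice_holomorphic_on I (slice_plane I - \<gamma>_img I 0) f"
    unfolding f_def
  proof (rule slice_holomorphic_on_complex[OF I, where F = "\<lambda>z. bent_Ln (z - 2 * \<i>)"])
    show "((\<lambda>z. bent_Ln (z - 2 * \<i>)) has_field_derivative 1 / (z - 2 * \<i>)) (at z)" if "z \<in> A" for z
      using has_field_derivative_bent_Ln[of "z - 2 * \<i>"] that
        DERIV_shift[of bent_Ln "1 / (z - 2 * \<i>)" z "- (2 * \<i>)"]
      by (simp add: A_def)
    \<comment> \<open>This keeps the pole \<open>2 * \<i>\<close> out of \<open>A\<close>.\<close>
    have "0 \<in> log_cut" by (simp add: log_cut_def)
    then show "continuous_on A (\<lambda>z. 1 / (z - 2 * \<i>))"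
      by (intro continuous_intros) (auto simp: A_def)
    show "slice_plane I - \<gamma>_img I 0 \<subseteq> slice_emb I ` A"
    proof
      fix q assume "q \<in> slice_plane I - \<gamma>_img I 0"
      then obtain x y where q: "q = slice_pt I x y" "q \<notin> \<gamma>_img I 0"
        by (auto simp: slice_plane_def)
      then have "Complex x y \<in> A"
        using log_cut_subset_\<gamma>_img[OF I] by (auto simp: A_def shift)
      moreover have "q = slice_emb I (Complex x y)"
        using q by (simp add: slice_emb_def)
      ultimately show "q \<in> slice_emb I ` A" by blast
    qed
  qed
  moreover have "f (of_real x + 2 * I) = of_real (ln x)" if "x > 0" for x
  proof -
    have "slice_coord I (of_real x + 2 * I) - 2 * \<i> = of_real x"
      by (simp add: slice_pt_const(4) slice_coord_slice_pt[OF I] complex_eq_iff)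
    moreover have "\<not> cmod (of_real x + 1) < 1"
      using that abs_Re_le_cmod[of "of_real x + 1"] by simp
    ultimately show ?thesis
      using that by (simp add: f_def bent_Ln_def Ln_of_real)
  qed
  ultimately have "is_log_extension I 0 f"
    unfolding is_log_extension_def by (auto simp: f_def slice_emb_def slice_plane_def)
  then show ?thesis
    unfolding log_ext_def by (rule someI[of "is_log_extension I 0"])
qed


section \<open>The completion\<close>

lemma T_param_self [simp]: "T_param I I = 0"
  by (simp add: T_param_def)

lemma T_param_uminus:
  assumes "I \<in> \<S>"
  shows "T_param I (- I) = 1"
proof -
  have "- I - I = (- 2) *\<^sub>R I" by (simp add: scaleR_2)
  then show ?thesis
    using imag_unitD(4)[OF assms] by (simp add: T_param_def)
qed

text \<open>\<open>slice_proj I J\<close> is injective on \<open>slice_plane I\<close>, so avoiding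
  the projected curve can be tested in \<open>slice_plane I\<close>.\<close>

lemma slice_pt_mem_U_plus:
  assumes "I \<in> \<S>" "J \<in> \<S>" "0 \<le> y" "slice_pt I x y \<notin> \<gamma>_img I (T_param I J)"
  shows "slice_pt J x y \<in> U_plus I J"
proof -
  have "slice_pt J x y \<noteq> slice_proj I J q" if q: "q \<in> \<gamma>_img I (T_param I J)" for q
  proof
    assume eq: "slice_pt J x y = slice_proj I J q"
    obtain a b where "q = slice_pt I a b"
      using q by (auto simp: \<gamma>_img_def \<gamma>_curve_eq[OF assms(1)] split: if_splits)
    with eq have "q = slice_pt I x y"
      by (simp add: slice_proj_slice_pt[OF assms(1)] slice_pt_eq_iff[OF assms(2)])
    with q assms(4) show False by simp
  qed
  then show ?thesis
    using assms(3) by (auto simp: U_plus_def half_plane_def)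
qed

text \<open>A point off \<open>\<gamma>_img I 0\<close> is reached with \<open>J = I\<close>, where
  \<open>T_param\<close> is 0, and a point off \<open>\<gamma>_img I 1\<close> with
  \<open>J = - I\<close>, where it is 1.\<close>

lemma punctured_disc_in_symmetric_completion:
  assumes I: "I \<in> \<S>" and w: "w \<in> ball 0 2 - {0}"
  shows "slice_emb I (w + 2 * \<i>) \<in> symmetric_completion (\<Omega>_dom I)"
proof -
  \<comment> \<open>Radius 2 about \<open>2 * \<i>\<close> stays in the upper half plane, as
    \<open>half_plane\<close> demands.\<close>
  have "\<bar>Im w\<bar> < 2"
    using w abs_Im_le_cmod[of w] by auto
  then have "0 \<le> Im w + 2" by simp
  then have "\<exists>J\<in>\<S>. slice_pt J (Re w) (Im w + 2) \<in> U_plus I J"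
    using not_in_both_\<gamma>_img[OF I w] slice_pt_mem_U_plus[OF I I]
      slice_pt_mem_U_plus[OF I uminus_imag_unit[OF I]] I uminus_imag_unit[OF I]
    by (metis T_param_self T_param_uminus[OF I])
  then show ?thesis
    using I by (fastforce simp: symmetric_completion_def \<Omega>_dom_def slice_emb_def)
qed

text \<open>With \<open>I * I = - 1\<close> the two coefficients become 1 and 0.\<close>

lemma F_plus_self:
  assumes "I \<in> \<S>"
  shows "F_plus I I (slice_pt I x y) = log_ext I 0 (slice_pt I x y)"
proof -
  have "qre (slice_pt I x y) = x" "I \<bullet> slice_pt I x y = y"
    using slice_coord_slice_pt[OF assms, of x y] by (auto simp: slice_coord_def)
  then show ?thesis
    using imag_unitD(2)[OF assms] by (simp add: F_plus_def Let_def)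
qed

theorem mainTheorem2:
  fixes I :: quat and G :: "quat \<Rightarrow> quat"
  assumes "I \<in> \<S>"
    and "slice_regular_on (\<Omega>_dom I) G"
    and "\<And>J q. J \<in> \<S> \<Longrightarrow> q \<in> U_plus I J \<Longrightarrow> G q = F_plus I J q"
  shows "\<nexists>G'. slice_regular_on (symmetric_completion (\<Omega>_dom I)) G' \<and> (\<forall>q\<in>\<Omega>_dom I. G' q = G q)"
proof
  note I = assms(1)
  assume "\<exists>G'. slice_regular_on (symmetric_completion (\<Omega>_dom I)) G' \<and> (\<forall>q\<in>\<Omega>_dom I. G' q = G q)"
  then obtain G' where reg: "slice_regular_on (symmetric_completion (\<Omega>_dom I)) G'"
    and ext: "\<And>q. q \<in> \<Omega>_dom I \<Longrightarrow> G' q = G q" by blast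
  define B where "B = ball (0::complex) 2 - {0}"
  \<comment> \<open>The values of \<open>G'\<close> may leave \<open>slice_plane I\<close>; their
    projection to it is a complex function.\<close>
  define g where "g = (\<lambda>z. slice_coord I (G' (slice_emb I z)))"
  have "g holomorphic_on (\<lambda>w. w + 2 * \<i>) ` B"
    unfolding g_def
  proof (rule slice_holomorphic_coord[OF I])
    show "slice_holomorphic_on I (symmetric_completion (\<Omega>_dom I) \<inter> slice_plane I) G'"
      using reg I by (simp add: slice_regular_on_def)
    show "open ((\<lambda>w. w + 2 * \<i>) ` B)"
      using open_translation[of B "2 * \<i>"] by (simp add: B_def open_delete add.commute)
    show "slice_emb I ` (\<lambda>w. w + 2 * \<i>) ` B \<subseteq> symmetric_completion (\<Omega>_dom I) \<inter> slice_plane I"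
    proof safe
      fix w assume "w \<in> B"
      then show "slice_emb I (w + 2 * \<i>) \<in> symmetric_completion (\<Omega>_dom I)"
        unfolding B_def by (rule punctured_disc_in_symmetric_completion[OF I])
      show "slice_emb I (w + 2 * \<i>) \<in> slice_plane I"
        by (auto simp: slice_plane_def slice_emb_def)
    qed
  qed
  then have "(g \<circ> (\<lambda>w. w + 2 * \<i>)) holomorphic_on B"
    by (intro holomorphic_on_compose holomorphic_intros)
  moreover have "g (of_real x + 2 * \<i>) = of_real (ln x)" if "0 < x" for x
  proof -
    \<comment> \<open>Both the arc and the ray have nonpositive real part.\<close>
    have "slice_pt I x 2 \<notin> \<gamma>_img I 0"
      using \<gamma>_img_cases[OF I, of x 2 0] that by (smt (verit) cos_le_one)
    then have U: "slice_pt I x 2 \<in> U_plus I I"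
      using slice_pt_mem_U_plus[OF I I] by simp
    then have "slice_pt I x 2 \<in> \<Omega>_dom I"
      using I by (auto simp: \<Omega>_dom_def)
    then have "G' (slice_pt I x 2) = log_ext I 0 (slice_pt I x 2)"
      using ext assms(3)[OF I U] by (simp add: F_plus_self[OF I])
    also have "\<dots> = of_real (ln x)"
      using is_log_extension_log_ext_0[OF I] that
      by (simp add: is_log_extension_def slice_pt_const(4))
    \<comment> \<open>The value is real, so the projection leaves it unchanged.\<close>
    finally show ?thesis
      using slice_coord_slice_emb[OF I, of "of_real (ln x)"]
      by (simp add: g_def slice_emb_of_real) (simp add: slice_emb_def)
  qed
  ultimately show False
    using no_log_on_punctured_ball[of 2 "g \<circ> (\<lambda>w. w + 2 * \<i>)"] by (simp add: B_def)
qed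

end
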